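(* Let $G$ be a finite simple graph with vertex set $V$, let $C\subseteq V$ be a nonempty clique of $G$, and let $\tilde G=cs(G,C)$ with new vertex $v$. Let $\mathcal{A}'(\tilde G)$ be the set of arithmetical structures $(\mathbf{d}',\mathbf{r}')$ on $\tilde G$ with $\mathbf{d}'_v=1$. For $(\mathbf{d},\mathbf{r})\in\mathcal{A}(G)$ define $\tilde{\mathbf{d}},\tilde{\mathbf{r}}\in\mathbb{N}_+^{V\cup\{v\}}$ by $\tilde{\mathbf{d}}_u=\mathbf{d}_u$ for $u\in V\setminus C$, $\tilde{\mathbf{d}}_u=\mathbf{d}_u+1$ for $u\in C$, $\tilde{\mathbf{d}}_v=1$, and $\tilde{\mathbf{r}}_u=\mathbf{r}_u$ for $u\in V$, $\tilde{\mathbf{r}}_v=\sum_{u\in C}\mathbf{r}_u$. Then $\mathcal{A}'(\tilde G)=\{(\tilde{\mathbf{d}},\tilde{\mathbf{r}}) : (\mathbf{d},\mathbf{r})\in\mathcal{A}(G)\}$.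
   Context: A clique is a set of pairwise adjacent vertices. The clique–star transform $cs(G,C)$ is the graph obtained from $G$ by deleting all edges between vertices of $C$ and adding a new vertex $v$ joined by an edge to each vertex of $C$. For a graph $H$ with vertex set $W$ and adjacency matrix $A(H)$, and $\mathbf{d}\in\mathbb{Z}^W$, set $L(H,\mathbf{d})=\mathrm{diag}(\mathbf{d})-A(H)$. An arithmetical structure on $H$ is a pair $(\mathbf{d},\mathbf{r})\in\mathbb{N}_+^W\times\mathbb{N}_+^W$ ($\mathbb{N}_+$ = positive integers) with $\gcd(\mathbf{r}_w:w\in W)=1$ and $L(H,\mathbf{d})\mathbf{r}^t=\mathbf{0}^t$; $\mathcal{A}(H)$ denotes the set of arithmetical structures on $H$.
   Formalization: The formal theorem adds the hypothesis that every vertex of C has a neighbour in G (automatic if |C| ≥ 2); it excludes only C={u} with u isolated, where the claim fails, e.g. G=K_1: A(G) is empty but cs(G,C)=K_2 has the structure with all entries 1. *)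

theory Defs
  imports "Graph_Theory.Graph_Theory" "HOL-Library.FuncSet"
begin

text \<open>
  Finite simple graphs are the \<^const>\<open>pair_graph\<close>s: finite, loopfree, and every edge is present
  as a pair of opposite arcs. Vectors indexed by a vertex set \<open>W\<close> are integer functions that are
  extensional on \<open>W\<close>, so that equality of vectors is equality of functions.
\<close>

definition is_clique :: "'a pair_pre_digraph \<Rightarrow> 'a set \<Rightarrow> bool" where
  "is_clique G C \<longleftrightarrow> C \<subseteq> pverts G \<and> (\<forall>u\<in>C. \<forall>w\<in>C. u \<noteq> w \<longrightarrow> (u, w) \<in> parcs G)"

text \<open>The new vertex \<open>v\<close> is a parameter; it is meant to lie outside \<open>pverts G\<close>.\<close>

definition clique_star :: "'a pair_pre_digraph \<Rightarrow> 'a set \<Rightarrow> 'a \<Rightarrow> 'a pair_pre_digraph" where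
  "clique_star G C v =
     \<lparr> pverts = insert v (pverts G),
       parcs = (parcs G - C \<times> C) \<union> {v} \<times> C \<union> C \<times> {v} \<rparr>"

definition adj_matrix :: "'a pair_pre_digraph \<Rightarrow> 'a \<Rightarrow> 'a \<Rightarrow> int" where
  "adj_matrix H u w = (if (u, w) \<in> parcs H then 1 else 0)"

definition gen_laplacian :: "'a pair_pre_digraph \<Rightarrow> ('a \<Rightarrow> int) \<Rightarrow> 'a \<Rightarrow> 'a \<Rightarrow> int" where
  "gen_laplacian H d u w = (if u = w then d u else 0) - adj_matrix H u w"

definition arithmetical_structures ::
    "'a pair_pre_digraph \<Rightarrow> (('a \<Rightarrow> int) \<times> ('a \<Rightarrow> int)) set" where
  "arithmetical_structures H =
     {(d, r). d \<in> pverts H \<rightarrow>\<^sub>E {0<..} \<and> r \<in> pverts H \<rightarrow>\<^sub>E {0<..} \<and>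
        Gcd (r ` pverts H) = 1 \<and>
        (\<forall>u\<in>pverts H. (\<Sum>w\<in>pverts H. gen_laplacian H d u w * r w) = 0)}"

definition lift_d :: "'a pair_pre_digraph \<Rightarrow> 'a set \<Rightarrow> 'a \<Rightarrow> ('a \<Rightarrow> int) \<Rightarrow> 'a \<Rightarrow> int" where
  "lift_d G C v d =
     (\<lambda>u\<in>insert v (pverts G). if u = v then 1 else if u \<in> C then d u + 1 else d u)"

definition lift_r :: "'a pair_pre_digraph \<Rightarrow> 'a set \<Rightarrow> 'a \<Rightarrow> ('a \<Rightarrow> int) \<Rightarrow> 'a \<Rightarrow> int" where
  "lift_r G C v r =
     (\<lambda>u\<in>insert v (pverts G). if u = v then \<Sum>w\<in>C. r w else r u)"

text \<open>
  The description of the arithmetical structures of \<open>clique_star G C v\<close> with value 1 at \<open>v\<close> as the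
  lifts of those of \<open>G\<close> fails when \<open>C\<close> consists of a single isolated vertex \<open>u\<close>: then \<open>d u = 0\<close> is
  forced in \<open>G\<close>, whereas the clique--star transform turns \<open>u\<close> into an end of an isolated edge, which
  carries the structure with all entries 1. Hence the main theorem asks that no vertex of \<open>C\<close> be
  isolated in \<open>G\<close>, which is automatic as soon as \<open>C\<close> has two elements. The one-vertex graph is
  the smallest instance of the failure.
\<close>

lemma isolated_clique_counterexample:
  fixes u v :: 'a
  assumes "u \<noteq> v"
  defines "G \<equiv> \<lparr> pverts = {u}, parcs = {} \<rparr>"
  shows "pair_graph G" and "is_clique G {u}" and "v \<notin> pverts G"
    and "{(d', r'). (d', r') \<in> arithmetical_structures (clique_star G {u} v) \<and> d' v = 1}
       \<noteq> {(lift_d G {u} v d, lift_r G {u} v r) | d r. (d, r) \<in> arithmetical_structures G}"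
proof -
  show "pair_graph G"
    by unfold_locales (auto simp: G_def symmetric_def sym_def)
  show "is_clique G {u}" "v \<notin> pverts G"
    using assms by (auto simp: G_def is_clique_def)
  have "arithmetical_structures G = {}"
    by (auto simp: arithmetical_structures_def G_def gen_laplacian_def adj_matrix_def)
  moreover define e :: "'a \<Rightarrow> int" where "e = (\<lambda>w\<in>{v, u}. 1)"
  have "(e, e) \<in> arithmetical_structures (clique_star G {u} v)" "e v = 1"
    using assms
    by (auto simp: arithmetical_structures_def clique_star_def G_def gen_laplacian_def
        adj_matrix_def e_def)
  ultimately show "{(d', r'). (d', r') \<in> arithmetical_structures (clique_star G {u} v) \<and> d' v = 1}
       \<noteq> {(lift_d G {u} v d, lift_r G {u} v r) | d r. (d, r) \<in> arithmetical_structures G}"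
    by auto
qed

end

theory Submission
  imports Defs
begin

text \<open>
  If row \<open>v\<close> of the equation holds with \<open>d v = 1\<close>, then \<open>r v\<close> is the sum of \<open>r\<close> over \<open>C\<close>. In the row
  of a vertex \<open>u \<in> C\<close> this value replaces the sum over \<open>C - {u}\<close> contributed by the deleted clique
  edges, an excess of \<open>r u\<close> that is compensated by raising \<open>d u\<close> by one; the other rows do not change.
  The entry \<open>r v\<close> does not affect the gcd, being a sum of other entries. Lowering \<open>d\<close> by one
  on \<open>C\<close> keeps it positive because \<open>d u * r u\<close> is a sum of positive entries over the neighbours
  of \<open>u\<close> in \<open>G\<close>, and there is at least one neighbour.
\<close>

lemma gen_laplacian_row:
  assumes "finite (pverts H)" "u \<in> pverts H"
  shows "(\<Sum>w\<in>pverts H. gen_laplacian H d u w * r w)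
       = d u * r u - (\<Sum>w\<in>{w \<in> pverts H. (u, w) \<in> parcs H}. r w)"
proof -
  have "(\<Sum>w\<in>pverts H. gen_laplacian H d u w * r w)
      = (\<Sum>w\<in>pverts H. if u = w then d u * r w else 0)
        - (\<Sum>w\<in>pverts H. if (u, w) \<in> parcs H then r w else 0)"
    unfolding sum_subtractf[symmetric]
    by (intro sum.cong) (auto simp: gen_laplacian_def adj_matrix_def algebra_simps)
  then show ?thesis
    using assms by (simp add: sum.inter_filter)
qed

text \<open>The new vertex had no arcs in \<open>G\<close>, so its neighbours are exactly
  \<open>C\<close>. With \<open>d\<close> and \<open>r\<close> arbitrary, row \<open>v\<close> can
  be read off before the pair is known to be a lift.\<close>

lemma clique_star_row_new:
  assumes "pair_graph G" "is_clique G C" "v \<notin> pverts G"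
  shows "(\<Sum>w\<in>pverts (clique_star G C v). gen_laplacian (clique_star G C v) d v w * r w)
       = d v * r v - (\<Sum>w\<in>C. r w)"
proof -
  interpret pair_graph G by fact
  have "{w \<in> pverts (clique_star G C v). (v, w) \<in> parcs (clique_star G C v)} = C"
    using assms in_arcsD1 by (auto simp: clique_star_def is_clique_def)
  then show ?thesis
    using assms by (subst gen_laplacian_row) (auto simp: clique_star_def)
qed

text \<open>An identity of row sums, so that the row equations transfer in both directions.\<close>

lemma clique_star_row_old:
  assumes "pair_graph G" "is_clique G C" "v \<notin> pverts G" "u \<in> pverts G"
  shows "(\<Sum>w\<in>pverts (clique_star G C v).
            gen_laplacian (clique_star G C v) (lift_d G C v d) u w * lift_r G C v r w)
       = (\<Sum>w\<in>pverts G. gen_laplacian G d u w * r w)"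
proof -
  interpret pair_graph G by fact
  have C: "C \<subseteq> pverts G" "finite C" "v \<notin> C"
    using assms finite_subset[OF _ finite_verts] by (auto simp: is_clique_def)
  let ?H = "clique_star G C v"
  let ?N = "{w \<in> pverts G. (u, w) \<in> parcs G}"
  let ?N' = "{w \<in> pverts ?H. (u, w) \<in> parcs ?H}"
  let ?r = "lift_r G C v r"
  have r: "?r w = r w" if "w \<in> pverts G" for w
    using that assms by (auto simp: lift_r_def)
  have u: "u \<noteq> v" using assms by auto
  have fin: "finite (pverts ?H)" "u \<in> pverts ?H"
    using assms by (auto simp: clique_star_def)
  have "(\<Sum>w\<in>?N'. ?r w) = (\<Sum>w\<in>?N. r w) + (if u \<in> C then r u else 0)"
  proof (cases "u \<in> C")
    case True
    \<comment> \<open>\<open>G\<close> has no loops, so \<open>u\<close> is not in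
      \<open>?N\<close>, and deleting \<open>C - {u}\<close> from \<open>?N\<close> is the same as
      deleting \<open>C\<close>. Only the former is a subset of \<open>?N\<close>, as
      \<open>sum_diff\<close> requires.\<close>
    have N': "?N' = insert v (?N - (C - {u}))"
      using True u C no_loops[of "(u, u)"] assms by (auto simp: clique_star_def)
    have sub: "C - {u} \<subseteq> ?N"
      using True assms C by (auto simp: is_clique_def)
    have "(\<Sum>w\<in>?N'. ?r w) = ?r v + (\<Sum>w\<in>?N - (C - {u}). r w)"
      unfolding N' using assms by (simp add: r)
    also have "(\<Sum>w\<in>?N - (C - {u}). r w) = (\<Sum>w\<in>?N. r w) - (\<Sum>w\<in>C - {u}. r w)"
      using sub by (intro sum_diff) auto
    also have "?r v = r u + (\<Sum>w\<in>C - {u}. r w)"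
      using True C by (simp add: lift_r_def sum.remove)
    finally show ?thesis using True by simp
  next
    case False
    \<comment> \<open>No arc out of \<open>u\<close> lies in \<open>C \<times> C\<close>, and no arc
      of \<open>G\<close> ends at \<open>v\<close>.\<close>
    have "?N' = ?N"
      using False u assms in_arcsD2 by (auto simp: clique_star_def)
    then show ?thesis using False by (simp add: r)
  qed
  moreover have "lift_d G C v d u = d u + (if u \<in> C then 1 else 0)"
    using assms u by (simp add: lift_d_def)
  ultimately show ?thesis
    unfolding gen_laplacian_row[OF fin] gen_laplacian_row[OF finite_verts assms(4)]
    using assms(4) by (simp add: r algebra_simps)
qed

lemma Gcd_lift_r:
  assumes "C \<subseteq> pverts G" "v \<notin> pverts G"
  shows "Gcd (lift_r G C v r ` insert v (pverts G)) = Gcd (r ` pverts G)"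
proof -
  have img: "lift_r G C v r ` pverts G = r ` pverts G"
    using assms by (intro image_cong) (auto simp: lift_r_def)
  have "Gcd (r ` pverts G) dvd (\<Sum>w\<in>C. r w)"
    using assms by (intro dvd_sum Gcd_dvd) auto
  moreover have "lift_r G C v r v = (\<Sum>w\<in>C. r w)"
    by (simp add: lift_r_def)
  ultimately show ?thesis
    by (simp add: img gcd_proj2_if_dvd_int)
qed

text \<open>As an equivalence this serves both inclusions of the theorem. Extensionality is assumed
  because a lift forgets the values of \<open>d\<close> and \<open>r\<close> outside
  \<open>pverts G\<close>.\<close>

lemma lift_mem_arithmetical_structures_iff:
  assumes "pair_graph G" "is_clique G C" "C \<noteq> {}" "v \<notin> pverts G"
    and nbr: "\<forall>u\<in>C. \<exists>w\<in>pverts G. (u, w) \<in> parcs G"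
    and ext: "d \<in> extensional (pverts G)" "r \<in> extensional (pverts G)"
  shows "(lift_d G C v d, lift_r G C v r) \<in> arithmetical_structures (clique_star G C v)
     \<longleftrightarrow> (d, r) \<in> arithmetical_structures G"
proof -
  interpret pair_graph G by fact
  have C: "C \<subseteq> pverts G" "finite C"
    using assms finite_subset[OF _ finite_verts] by (auto simp: is_clique_def)
  have pv: "pverts (clique_star G C v) = insert v (pverts G)"
    by (simp add: clique_star_def)
  let ?row = "\<lambda>u. \<Sum>w\<in>pverts G. gen_laplacian G d u w * r w"
  have row_v: "(\<Sum>w\<in>pverts (clique_star G C v).
      gen_laplacian (clique_star G C v) (lift_d G C v d) v w * lift_r G C v r w) = 0"
  proof -
    have "(\<Sum>w\<in>C. lift_r G C v r w) = (\<Sum>w\<in>C. r w)"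
      using C assms by (intro sum.cong) (auto simp: lift_r_def)
    then show ?thesis
      using assms by (subst clique_star_row_new) (auto simp: lift_d_def lift_r_def)
  qed
  have rpos: "lift_r G C v r \<in> insert v (pverts G) \<rightarrow>\<^sub>E {0<..} \<longleftrightarrow> r \<in> pverts G \<rightarrow>\<^sub>E {0<..}"
  proof
    assume "r \<in> pverts G \<rightarrow>\<^sub>E {0<..}"
    then have "\<forall>w\<in>pverts G. 0 < r w" by auto
    moreover from this have "0 < (\<Sum>w\<in>C. r w)"
      using C assms by (intro sum_pos) auto
    ultimately show "lift_r G C v r \<in> insert v (pverts G) \<rightarrow>\<^sub>E {0<..}"
      by (auto simp: lift_r_def)
  next
    assume L: "lift_r G C v r \<in> insert v (pverts G) \<rightarrow>\<^sub>E {0<..}"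
    have "0 < r u" if "u \<in> pverts G" for u
      using PiE_mem[OF L, of u] that assms by (auto simp: lift_r_def split: if_splits)
    then show "r \<in> pverts G \<rightarrow>\<^sub>E {0<..}"
      using ext by (auto simp: PiE_iff)
  qed
  \<comment> \<open>On \<open>C\<close>, positivity of the lift only gives
    \<open>0 \<le> d u\<close>. Excluding 0 takes the row equation and positive \<open>r\<close>,
    hence the conditional form.\<close>
  have dpos: "lift_d G C v d \<in> insert v (pverts G) \<rightarrow>\<^sub>E {0<..} \<longleftrightarrow> d \<in> pverts G \<rightarrow>\<^sub>E {0<..}"
    if r: "r \<in> pverts G \<rightarrow>\<^sub>E {0<..}" and row: "\<forall>u\<in>pverts G. ?row u = 0"
  proof
    assume "d \<in> pverts G \<rightarrow>\<^sub>E {0<..}"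
    then have "\<forall>w\<in>pverts G. 0 < d w" by auto
    then show "lift_d G C v d \<in> insert v (pverts G) \<rightarrow>\<^sub>E {0<..}"
      by (auto simp: lift_d_def add_pos_pos)
  next
    assume L: "lift_d G C v d \<in> insert v (pverts G) \<rightarrow>\<^sub>E {0<..}"
    have "0 < d u" if u: "u \<in> pverts G" for u
    proof (cases "u \<in> C")
      case True
      let ?N = "{w \<in> pverts G. (u, w) \<in> parcs G}"
      have "0 < (\<Sum>w\<in>?N. r w)"
        using r nbr True by (intro sum_pos) auto
      also have "\<dots> = d u * r u"
        using row u gen_laplacian_row[OF finite_verts, of u d r] by simp
      finally show ?thesis
        using PiE_mem[OF r u] by (simp add: zero_less_mult_iff)
    next
      case False
      then show ?thesis
        using PiE_mem[OF L, of u] u assms by (auto simp: lift_d_def split: if_splits)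
    qed
    then show "d \<in> pverts G \<rightarrow>\<^sub>E {0<..}"
      using ext by (auto simp: PiE_iff)
  qed
  have rows: "(\<forall>u\<in>pverts (clique_star G C v). (\<Sum>w\<in>pverts (clique_star G C v).
      gen_laplacian (clique_star G C v) (lift_d G C v d) u w * lift_r G C v r w) = 0)
    \<longleftrightarrow> (\<forall>u\<in>pverts G. ?row u = 0)"
    using row_v clique_star_row_old[OF assms(1,2,4)] pv by auto
  show ?thesis
    unfolding arithmetical_structures_def mem_Collect_eq case_prod_conv rows
    unfolding pv Gcd_lift_r[OF C(1) assms(4)] rpos
    \<comment> \<open>The premises of \<open>dpos\<close> are conjuncts common to both
      sides.\<close>
    using dpos by blast
qed

theorem theorem5p1:
  fixes G :: "'a pair_pre_digraph" and C :: "'a set" and v :: 'a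
  assumes "pair_graph G"
    and "is_clique G C"
    and "C \<noteq> {}"
    and "v \<notin> pverts G"
    and "\<forall>u\<in>C. \<exists>w\<in>pverts G. (u, w) \<in> parcs G"
  shows "{(d', r'). (d', r') \<in> arithmetical_structures (clique_star G C v) \<and> d' v = 1}
       = {(lift_d G C v d, lift_r G C v r) | d r. (d, r) \<in> arithmetical_structures G}"
proof -
  interpret pair_graph G by fact
  note lift_iff = lift_mem_arithmetical_structures_iff[OF assms]
  have "\<exists>d r. d' = lift_d G C v d \<and> r' = lift_r G C v r \<and> (d, r) \<in> arithmetical_structures G"
    if A: "(d', r') \<in> arithmetical_structures (clique_star G C v)" and v: "d' v = 1" for d' r'
  proof -
    \<comment> \<open>The only candidate preimage, restricted to \<open>pverts G\<close> to be
      extensional there. That \<open>d\<close> is positive on \<open>C\<close> is not yet known; it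
      comes out of \<open>lift_iff\<close>.\<close>
    define d where "d = (\<lambda>u\<in>pverts G. if u \<in> C then d' u - 1 else d' u)"
    define r where "r = restrict r' (pverts G)"
    have C: "C \<subseteq> pverts G" using assms by (simp add: is_clique_def)
    have ext: "d' \<in> extensional (insert v (pverts G))" "r' \<in> extensional (insert v (pverts G))"
      using A by (auto simp: arithmetical_structures_def clique_star_def PiE_iff)
    have "(\<Sum>w\<in>pverts (clique_star G C v). gen_laplacian (clique_star G C v) d' v w * r' w) = 0"
      using A by (auto simp: arithmetical_structures_def clique_star_def)
    then have r'v: "r' v = (\<Sum>w\<in>C. r' w)"
      using v assms by (simp add: clique_star_row_new)
    also have "\<dots> = (\<Sum>w\<in>C. r w)"
      using C by (intro sum.cong) (auto simp: r_def)
    finally have "r' = lift_r G C v r"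
      by (intro extensionalityI[OF ext(2)]) (auto simp: lift_r_def r_def)
    \<comment> \<open>At \<open>v\<close> this is the assumption \<open>d' v = 1\<close>.\<close>
    moreover have "d' = lift_d G C v d"
      using v by (intro extensionalityI[OF ext(1)]) (auto simp: lift_d_def d_def)
    ultimately show ?thesis
      using A lift_iff[of d r] by (auto simp: d_def r_def)
  qed
  moreover have "(lift_d G C v d, lift_r G C v r) \<in> arithmetical_structures (clique_star G C v)"
    if "(d, r) \<in> arithmetical_structures G" for d r
    using that lift_iff[of d r] by (auto simp: arithmetical_structures_def PiE_iff)
  moreover have "lift_d G C v d v = 1" for d
    by (simp add: lift_d_def)
  ultimately show ?thesis by (auto 0 3)
qed

end
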